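(* Let $R_1$ and $R_2$ be two finite rings with subrings $S_1, K_1$ and $S_2, K_2$ respectively such that $S_1 \subseteq K_1$ and $S_2 \subseteq K_2$. Suppose the pairs $(S_1, K_1)$ and $(S_2, K_2)$ are generalized $\mathbb{Z}$-isoclinic. If $|Z(K_1) \cap S_1| = |Z(K_2) \cap S_2|$ and $|Z(K_1)| = |Z(K_2)|$, then the graphs $\Gamma_{S_1,K_1}$ and $\Gamma_{S_2,K_2}$ are isomorphic.
   Context: Rings are associative and not assumed to have a unity. $Z(A)$ denotes the center of a ring $A$; $[u,v] = uv - vu$, and for subrings $S \subseteq K$, $[S,K]$ denotes the additive subgroup generated by all $[s,k]$ with $s \in S$, $k \in K$. The pair $(S_1,K_1)$ is generalized $\mathbb{Z}$-isoclinic to $(S_2,K_2)$ if there exist additive group isomorphisms $\phi : \frac{K_1}{Z(K_1) \cap S_1} \to \frac{K_2}{Z(K_2) \cap S_2}$ with $\phi\left(\frac{S_1}{Z(K_1) \cap S_1}\right) = \frac{S_2}{Z(K_2) \cap S_2}$, and $\psi : [S_1,K_1] \to [S_2,K_2]$, such that $\psi([u,v]) = [u',v']$ whenever $u \in S_1$, $u' \in S_2$, $v \in K_1$, $v' \in K_2$, $\phi(u + (Z(K_1) \cap S_1)) = u' + (Z(K_2) \cap S_2)$ and $\phi(v + (Z(K_1) \cap S_1)) = v' + (Z(K_2) \cap S_2)$. For subrings $S \subseteq K$ of a finite ring, put $C_K(S) = \{k \in K : ks = sk \ \forall s \in S\}$; the generalized non-commuting graph $\Gamma_{S,K}$ is the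 simple graph with vertex set $K \setminus C_K(S)$ in which two distinct vertices $a, b$ are adjacent if and only if ($a \in S$ or $b \in S$) and $ab \neq ba$. *)

theory Defs
  imports
    "HOL-Algebra.Coset"
    "HOL-Algebra.Generated_Groups"
    "Graph_Theory.Pair_Digraph"
    "Graph_Theory.Digraph_Isomorphism"
begin

text \<open>
  The ambient rings are types of class \<open>ring\<close>: associative, no unity and no commutativity
  assumed. Subrings are subsets of such a type and need not contain a unity either.
\<close>

definition subring_set :: "'a::ring set \<Rightarrow> bool" where
  "subring_set A \<longleftrightarrow> 0 \<in> A \<and> (\<forall>x\<in>A. \<forall>y\<in>A. x - y \<in> A \<and> x * y \<in> A)"

definition ring_center :: "'a::ring set \<Rightarrow> 'a set" where
  "ring_center A = {z \<in> A. \<forall>a\<in>A. z * a = a * z}"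

definition ring_centralizer :: "'a::ring set \<Rightarrow> 'a set \<Rightarrow> 'a set" where
  "ring_centralizer K S = {k \<in> K. \<forall>s\<in>S. k * s = s * k}"

definition ring_comm :: "'a::ring \<Rightarrow> 'a \<Rightarrow> 'a" where
  "ring_comm u v = u * v - v * u"

text \<open>
  The additive group on a subset, as a HOL-Algebra group, so that quotients, generated subgroups
  and isomorphisms are the library ones. A coset \<open>N #>\<^bsub>additive_group K\<^esub> u\<close> is \<open>u + N\<close>.
\<close>

definition additive_group :: "'a::ring set \<Rightarrow> 'a monoid" where
  "additive_group A = \<lparr>carrier = A, monoid.mult = (+), one = 0\<rparr>"

definition commutator_group :: "'a::ring set \<Rightarrow> 'a set \<Rightarrow> 'a set" where
  "commutator_group S K =
     generate (additive_group UNIV) {ring_comm s k | s k. s \<in> S \<and> k \<in> K}"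

definition generalized_Z_isoclinic ::
  "'a::ring set \<Rightarrow> 'a set \<Rightarrow> 'b::ring set \<Rightarrow> 'b set \<Rightarrow> bool" where
  "generalized_Z_isoclinic S1 K1 S2 K2 \<longleftrightarrow>
    (\<exists>\<phi> \<psi>.
      \<phi> \<in> iso (additive_group K1 Mod (ring_center K1 \<inter> S1))
              (additive_group K2 Mod (ring_center K2 \<inter> S2)) \<and>
      \<phi> ` carrier (additive_group S1 Mod (ring_center K1 \<inter> S1)) =
          carrier (additive_group S2 Mod (ring_center K2 \<inter> S2)) \<and>
      \<psi> \<in> iso (additive_group (commutator_group S1 K1))
              (additive_group (commutator_group S2 K2)) \<and>
      (\<forall>u\<in>S1. \<forall>u'\<in>S2. \<forall>v\<in>K1. \<forall>v'\<in>K2.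
         \<phi> ((ring_center K1 \<inter> S1) #>\<^bsub>additive_group K1\<^esub> u) =
            (ring_center K2 \<inter> S2) #>\<^bsub>additive_group K2\<^esub> u' \<longrightarrow>
         \<phi> ((ring_center K1 \<inter> S1) #>\<^bsub>additive_group K1\<^esub> v) =
            (ring_center K2 \<inter> S2) #>\<^bsub>additive_group K2\<^esub> v' \<longrightarrow>
         \<psi> (ring_comm u v) = ring_comm u' v'))"

text \<open>
  Simple graphs are, as usual in Graph\<open>_\<close>Theory, finite symmetric loop-free digraphs without
  parallel arcs: an edge \<open>{a, b}\<close> is represented by the two arcs \<open>(a, b)\<close> and \<open>(b, a)\<close>.
\<close>

definition noncommuting_graph :: "'a::ring set \<Rightarrow> 'a set \<Rightarrow> 'a pair_pre_digraph" where
  "noncommuting_graph S K =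
     \<lparr>pverts = K - ring_centralizer K S,
      parcs = {(a, b). a \<in> K - ring_centralizer K S \<and> b \<in> K - ring_centralizer K S \<and>
                       a \<noteq> b \<and> (a \<in> S \<or> b \<in> S) \<and> a * b \<noteq> b * a}\<rparr>"

lemma group_additive_group:
  assumes "subring_set A"
  shows "comm_group (additive_group A)"
proof -
  have m: "- x \<in> A" if "x \<in> A" for x
    using assms that unfolding subring_set_def by (metis diff_0)
  have "x + y \<in> A" if "x \<in> A" "y \<in> A" for x y
    using assms that m[of y] unfolding subring_set_def by (metis diff_minus_eq_add)
  then show ?thesis
    using assms m
    by (intro comm_groupI)
      (auto simp: additive_group_def subring_set_def add.assoc add.commute
        intro: bexI[where x = "- x" for x])
qed

lemma r_coset_additive_group: "N #>\<^bsub>additive_group K\<^esub> u = (\<lambda>n. u + n) ` N"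
  by (auto simp: r_coset_def additive_group_def add.commute)

lemma normal_center_Int:
  assumes "subring_set S" "subring_set K" "S \<subseteq> K"
  shows "(ring_center K \<inter> S) \<lhd> additive_group K"
proof -
  interpret comm_group "additive_group K"
    by (rule group_additive_group[OF assms(2)])
  let ?N = "ring_center K \<inter> S"
  have sub: "x - y \<in> ?N" if "x \<in> ?N" "y \<in> ?N" for x y
    using that assms by (auto simp: ring_center_def subring_set_def algebra_simps)
  have z: "0 \<in> ?N"
    using assms by (auto simp: ring_center_def subring_set_def)
  have neg: "- x \<in> ?N" if "x \<in> ?N" for x
    using sub[OF z that] by simp
  have add: "x + y \<in> ?N" if "x \<in> ?N" "y \<in> ?N" for x y
    using sub[OF that(1) neg[OF that(2)]] by simp
  have sK: "?N \<subseteq> K"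
    using assms(3) by blast
  have inv: "inv\<^bsub>additive_group K\<^esub> x = - x" if "x \<in> ?N" for x
    using that neg[OF that] sK by (intro inv_equality) (auto simp: additive_group_def)
  have "subgroup ?N (additive_group K)"
    using z sK add neg by (intro subgroupI) (auto simp: inv, auto simp: additive_group_def)
  then show ?thesis
    by (rule subgroup_imp_normal)
qed

lemma pair_graph_noncommuting_graph:
  fixes S K :: "'a::{ring,finite} set"
  shows "pair_graph (noncommuting_graph S K)"
  by unfold_locales
    (auto simp: noncommuting_graph_def Digraph.symmetric_def intro!: symI)

lemma digraph_iso_noncommuting_graph_iff:
  fixes S1 K1 :: "'a::ring set" and S2 K2 :: "'b::ring set"
  defines "G \<equiv> noncommuting_graph S1 K1" and "H \<equiv> noncommuting_graph S2 K2"
  shows "digraph_iso (with_proj G) (with_proj H) \<longleftrightarrow>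
    (\<exists>f. bij_betw f (pverts G) (pverts H) \<and>
      (\<forall>a\<in>pverts G. \<forall>b\<in>pverts G. (a, b) \<in> parcs G \<longleftrightarrow> (f a, f b) \<in> parcs H))"
  (is "?L \<longleftrightarrow> ?R")
proof
  have wfG: "a \<in> pverts G \<and> b \<in> pverts G" if "(a, b) \<in> parcs G" for a b
    using that by (auto simp: G_def noncommuting_graph_def)
  have wfH: "a \<in> pverts H \<and> b \<in> pverts H" if "(a, b) \<in> parcs H" for a b
    using that by (auto simp: H_def noncommuting_graph_def)
  {
    assume ?L
    then obtain h where h: "pre_digraph.digraph_isomorphism (with_proj G) h"
      and H: "with_proj H = app_iso h (with_proj G)"
      by (auto simp: digraph_iso_def)
    have eqs: "pverts H = iso_verts h ` pverts G" "parcs H = iso_arcs h ` parcs G"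
      "iso_tail h = fst" "iso_head h = snd"
      using H by (auto simp: with_proj_def app_iso_def)
    have inj: "inj_on (iso_verts h) (pverts G)"
      using h by (auto simp: pre_digraph.digraph_isomorphism_def)
    have arc: "iso_arcs h (a, b) = (iso_verts h a, iso_verts h b)" if "(a, b) \<in> parcs G" for a b
      using h that by (force simp: pre_digraph.digraph_isomorphism_def eqs prod_eq_iff)
    have "(a, b) \<in> parcs G"
      if ab: "a \<in> pverts G" "b \<in> pverts G" and "(iso_verts h a, iso_verts h b) \<in> parcs H" for a b
    proof -
      obtain c d where cd: "(c, d) \<in> parcs G" "iso_arcs h (c, d) = (iso_verts h a, iso_verts h b)"
        using \<open>(iso_verts h a, iso_verts h b) \<in> parcs H\<close> unfolding eqs by force
      then have "iso_verts h c = iso_verts h a" "iso_verts h d = iso_verts h b"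
        using arc by auto
      then show ?thesis
        using inj_onD[OF inj] ab wfG[OF cd(1)] cd(1) by metis
    qed
    moreover have "(iso_verts h a, iso_verts h b) \<in> parcs H" if "(a, b) \<in> parcs G" for a b
      using arc[OF that] that unfolding eqs by (metis imageI)
    ultimately show ?R
      using inj eqs(1) by (intro exI[of _ "iso_verts h"]) (auto simp: bij_betw_def)
  }
  {
    assume ?R
    then obtain f where f: "bij_betw f (pverts G) (pverts H)"
      and e: "\<And>a b. a \<in> pverts G \<Longrightarrow> b \<in> pverts G \<Longrightarrow> (a, b) \<in> parcs G \<longleftrightarrow> (f a, f b) \<in> parcs H"
      by blast
    let ?h = "\<lparr>iso_verts = f, iso_arcs = map_prod f f, iso_head = snd, iso_tail = fst\<rparr>"
    have inj: "inj_on f (pverts G)" and im: "f ` pverts G = pverts H"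
      using f by (auto simp: bij_betw_def)
    have wf: "wf_digraph (with_proj G)"
      using wfG by unfold_locales auto
    have "inj_on (map_prod f f) (parcs G)"
      using wfG by (intro inj_on_subset[OF map_prod_inj_on[OF inj inj]]) auto
    then have "pre_digraph.digraph_isomorphism (with_proj G) ?h"
      using inj wf by (auto simp: pre_digraph.digraph_isomorphism_def)
    moreover have "map_prod f f ` parcs G = parcs H"
    proof
      show "map_prod f f ` parcs G \<subseteq> parcs H"
        using e wfG by auto
      show "parcs H \<subseteq> map_prod f f ` parcs G"
      proof
        fix p assume p: "p \<in> parcs H"
        obtain x y where xy: "p = (x, y)" by force
        obtain a b where ab: "a \<in> pverts G" "b \<in> pverts G" "x = f a" "y = f b"
          using wfH[of x y] p xy im by blast
        then have "(a, b) \<in> parcs G"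
          using e p xy by blast
        then show "p \<in> map_prod f f ` parcs G"
          using xy ab by force
      qed
    qed
    then have "with_proj H = app_iso ?h (with_proj G)"
      using im by (auto simp: with_proj_def app_iso_def)
    ultimately show ?L
      unfolding digraph_iso_def by blast
  }
qed

end

theory Submission
  imports Defs
begin

text \<open>
  Write \<open>N\<^sub>i = Z(K\<^sub>i) \<inter> S\<^sub>i\<close>. All cosets of \<open>N\<^sub>1\<close> and \<open>N\<^sub>2\<close> have the same finite size, so the
  bijection \<open>\<phi>\<close> between the quotients lifts to a bijection \<open>f : K\<^sub>1 \<rightarrow> K\<^sub>2\<close>, and any such lift maps
  \<open>S\<^sub>1\<close> onto \<open>S\<^sub>2\<close>. Since \<open>[f s, f k] = \<psi> [s, k]\<close> for \<open>s \<in> S\<^sub>1\<close>, \<open>k \<in> K\<^sub>1\<close>, and \<open>\<psi>\<close> is injective with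
  \<open>\<psi> 0 = 0\<close>, the map \<open>f\<close> preserves and reflects commutation with elements of \<open>S\<^sub>1\<close>, hence the
  relative centralizers and the edges.
\<close>

text \<open>Matching fibres, that of \<open>p\<close> over \<open>c\<close> and that of
  \<open>q\<close> over \<open>\<phi> c\<close>, are finite of equal size, so a bijection between
  them can be chosen for each \<open>c\<close>. Gluing these choices along the fibres of
  \<open>p\<close> yields \<open>f\<close>.\<close>

lemma bij_betw_lift:
  assumes bij: "bij_betw \<phi> (p ` A) (q ` B)"
    and fin: "finite A" "finite B"
    and card: "\<And>a b. a \<in> A \<Longrightarrow> b \<in> B \<Longrightarrow> card {x \<in> A. p x = p a} = card {y \<in> B. q y = q b}"
  obtains f where "bij_betw f A B" and "\<And>a. a \<in> A \<Longrightarrow> q (f a) = \<phi> (p a)"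
proof -
  let ?F = "\<lambda>c. {x \<in> A. p x = c}" and ?G = "\<lambda>c. {y \<in> B. q y = \<phi> c}"
  have "\<exists>g. bij_betw g (?F c) (?G c)" if c: "c \<in> p ` A" for c
  proof -
    obtain a where a: "a \<in> A" "c = p a"
      using c by blast
    obtain b where b: "b \<in> B" "\<phi> c = q b"
      using bij_betwE[OF bij] c by blast
    show ?thesis
      using card[OF a(1) b(1)] a(2) b(2) fin by (intro finite_same_card_bij) auto
  qed
  then obtain g where g: "\<And>c. c \<in> p ` A \<Longrightarrow> bij_betw (g c) (?F c) (?G c)"
    by metis
  let ?f = "\<lambda>a. g (p a) a"
  have fB: "?f a \<in> B" and qf: "q (?f a) = \<phi> (p a)" if "a \<in> A" for a
    using bij_betwE[OF g[of "p a"]] that by auto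
  have "inj_on ?f A"
  \<comment> \<open>Equal values lie in one fibre of \<open>q\<close>, so injectivity of
    \<open>\<phi>\<close> puts both arguments in one fibre of \<open>p\<close>, where a single
    \<open>g (p a)\<close> acts.\<close>
  proof (rule inj_onI)
    fix a b assume ab: "a \<in> A" "b \<in> A" "?f a = ?f b"
    then have "\<phi> (p a) = \<phi> (p b)"
      using qf by metis
    then have "p a = p b"
      using ab inj_onD[OF bij_betw_imp_inj_on[OF bij]] by blast
    with ab show "a = b"
      using inj_onD[OF bij_betw_imp_inj_on[OF g[of "p a"]], of a b] by auto
  qed
  moreover have "b \<in> ?f ` A" if b: "b \<in> B" for b
  proof -
    obtain c where c: "c \<in> p ` A" "q b = \<phi> c"
      using bij_betw_imp_surj_on[OF bij] b by (metis imageE imageI)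
    then have "b \<in> g c ` ?F c"
      using bij_betw_imp_surj_on[OF g[OF c(1)]] b by blast
    then show ?thesis
      by auto
  qed
  ultimately have "bij_betw ?f A B"
    using fB by (auto simp: bij_betw_def)
  then show ?thesis
    using that qf by blast
qed

lemma subring_set_ring_center_Int:
  fixes S K :: "'a::ring set"
  assumes "subring_set S" and "subring_set K"
  shows "subring_set (ring_center K \<inter> S)"
proof -
  have comm: "(x - y) * a = a * (x - y)" "x * y * a = a * (x * y)"
    if "x * a = a * x" "y * a = a * y" for x y a :: 'a
    using that by (simp_all add: left_diff_distrib right_diff_distrib) (metis mult.assoc)
  have "x - y \<in> ring_center K \<inter> S \<and> x * y \<in> ring_center K \<inter> S"
    if "x \<in> ring_center K \<inter> S" "y \<in> ring_center K \<inter> S" for x y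
  proof -
    have xy: "x \<in> K" "x \<in> S" "y \<in> K" "y \<in> S"
      and "\<forall>a\<in>K. x * a = a * x" "\<forall>a\<in>K. y * a = a * y"
      using that unfolding ring_center_def by blast+
    then have "\<forall>a\<in>K. (x - y) * a = a * (x - y) \<and> x * y * a = a * (x * y)"
      using comm by blast
    with xy assms show ?thesis
      unfolding subring_set_def ring_center_def by blast
  qed
  moreover have "0 \<in> ring_center K \<inter> S"
    using assms by (simp add: subring_set_def ring_center_def)
  ultimately show ?thesis
    unfolding subring_set_def by blast
qed

lemma mem_additive_coset_iff:
  fixes x y :: "'a::ring"
  shows "y \<in> (+) x ` N \<longleftrightarrow> y - x \<in> N"
  by (force simp: algebra_simps image_iff)

lemma additive_coset_eq_iff:
  fixes x y :: "'a::ring"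
  assumes "subring_set N"
  shows "(+) y ` N = (+) x ` N \<longleftrightarrow> y - x \<in> N"
proof
  have N: "0 \<in> N" "\<And>a b. a \<in> N \<Longrightarrow> b \<in> N \<Longrightarrow> a - b \<in> N"
    using assms by (auto simp: subring_set_def)
  show "y - x \<in> N" if "(+) y ` N = (+) x ` N"
    using that N(1) mem_additive_coset_iff[of y y N] mem_additive_coset_iff[of y x N] by simp
  show "(+) y ` N = (+) x ` N" if yx: "y - x \<in> N"
  proof -
    have "z - y \<in> N \<longleftrightarrow> z - x \<in> N" for z
    proof
      assume "z - x \<in> N"
      from N(2)[OF this yx] show "z - y \<in> N"
        by simp
    next
      assume "z - y \<in> N"
      \<comment> \<open>Closure under sums is obtained from subtraction: z - x = (z - y) - (0 - (y -
        x)).\<close>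
      from N(2)[OF this N(2)[OF N(1) yx]] show "z - x \<in> N"
        by simp
    qed
    then show ?thesis
      by (simp add: set_eq_iff mem_additive_coset_iff)
  qed
qed

text \<open>Since \<open>N \<subseteq> K\<close>, a coset of an element of \<open>K\<close> never
  leaves \<open>K\<close>. This serves both to count fibres of the quotient map and, with a subring
  \<open>S\<close> in the role of \<open>K\<close>, to see that \<open>S\<close> is a union of
  cosets.\<close>

lemma additive_coset_fibre:
  fixes x :: "'a::ring"
  assumes "subring_set N" and "subring_set K" and "N \<subseteq> K" and "x \<in> K"
  shows "{y \<in> K. (+) y ` N = (+) x ` N} = (+) x ` N"
proof -
  have "y \<in> K" if "y - x \<in> N" for y
  proof -
    have "0 - x \<in> K" "y - x \<in> K"
      using assms that unfolding subring_set_def by blast+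
    then have "y - x - (0 - x) \<in> K"
      using assms(2) unfolding subring_set_def by blast
    then show ?thesis
      by simp
  qed
  then show ?thesis
    unfolding additive_coset_eq_iff[OF assms(1)] by (auto simp: mem_additive_coset_iff)
qed

text \<open>Presents the quotient as the image of a coset map, the shape that
  \<open>bij_betw_lift\<close> expects.\<close>

lemma carrier_additive_group_Mod:
  "carrier (additive_group A Mod N) = (\<lambda>x. (+) x ` N) ` A"
  by (auto simp: FactGroup_def RCOSETS_def r_coset_additive_group) (auto simp: additive_group_def)

lemma ring_comm_eq_0_iff: "ring_comm u v = 0 \<longleftrightarrow> u * v = v * u"
  by (simp add: ring_comm_def)

lemma ring_comm_in_commutator_group:
  "s \<in> S \<Longrightarrow> k \<in> K \<Longrightarrow> ring_comm s k \<in> commutator_group S K"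
  unfolding commutator_group_def by (rule generate.incl) blast

lemma isoclinic_lift:
  assumes S1: "subring_set S1" and K1: "subring_set K1" and SK1: "S1 \<subseteq> K1"
    and S2: "subring_set S2" and K2: "subring_set K2" and SK2: "S2 \<subseteq> K2"
    and fin: "finite K1" "finite K2"
    and iso: "generalized_Z_isoclinic S1 K1 S2 K2"
    and card: "card (ring_center K1 \<inter> S1) = card (ring_center K2 \<inter> S2)"
  obtains f where "bij_betw f K1 K2"
    and "\<And>k. k \<in> K1 \<Longrightarrow> f k \<in> S2 \<longleftrightarrow> k \<in> S1"
    and "\<And>s k. s \<in> S1 \<Longrightarrow> k \<in> K1 \<Longrightarrow> f s * f k = f k * f s \<longleftrightarrow> s * k = k * s"
proof -
  define N1 where "N1 = ring_center K1 \<inter> S1"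
  define N2 where "N2 = ring_center K2 \<inter> S2"
  let ?p = "\<lambda>x. (+) x ` N1" and ?q = "\<lambda>x. (+) x ` N2"
  have N1: "subring_set N1" "N1 \<subseteq> S1" and N2: "subring_set N2" "N2 \<subseteq> S2"
    using subring_set_ring_center_Int S1 K1 S2 K2 by (auto simp: N1_def N2_def)
  obtain \<phi> \<psi> where phi: "bij_betw \<phi> (?p ` K1) (?q ` K2)"
    and phiS: "\<phi> ` ?p ` S1 = ?q ` S2"
    and psi: "bij_betw \<psi> (commutator_group S1 K1) (commutator_group S2 K2)"
    and compat: "\<forall>u\<in>S1. \<forall>u'\<in>S2. \<forall>v\<in>K1. \<forall>v'\<in>K2.
      \<phi> (?p u) = ?q u' \<longrightarrow> \<phi> (?p v) = ?q v' \<longrightarrow> \<psi> (ring_comm u v) = ring_comm u' v'"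
  proof -
    have carrier: "carrier (additive_group A) = A" for A :: "'c::ring set"
      by (simp add: additive_group_def)
    from iso show thesis
      unfolding generalized_Z_isoclinic_def iso_def carrier_additive_group_Mod carrier
        mem_Collect_eq r_coset_additive_group N1_def[symmetric] N2_def[symmetric]
      by (elim exE conjE) (rule that)
  qed
  \<comment> \<open>Both fibres are cosets, and translation is injective, so their sizes are those
    of \<open>N1\<close> and \<open>N2\<close>.\<close>
  have "card {x \<in> K1. ?p x = ?p a} = card {y \<in> K2. ?q y = ?q b}" if "a \<in> K1" "b \<in> K2" for a b
    using additive_coset_fibre[OF N1(1) K1 order.trans[OF N1(2) SK1] that(1)]
      additive_coset_fibre[OF N2(1) K2 order.trans[OF N2(2) SK2] that(2)]
      card[folded N1_def N2_def]
    by (simp add: card_image)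
  from bij_betw_lift[OF phi fin this]
  obtain f where f: "bij_betw f K1 K2" and qf: "\<And>k. k \<in> K1 \<Longrightarrow> ?q (f k) = \<phi> (?p k)"
    by blast
  have fK: "f k \<in> K2" if "k \<in> K1" for k
    using bij_betwE[OF f] that by blast
  \<comment> \<open>Membership in \<open>S\<close> depends only on the coset. The separate type
    \<open>'c\<close> allows use in both rings.\<close>
  have saturated: "x \<in> S" if "subring_set N" "subring_set S" "N \<subseteq> S" "s \<in> S" "(+) x ` N = (+) s ` N"
    for x s :: "'c::ring" and N S
    using additive_coset_fibre[OF that(1-4)] mem_additive_coset_iff[of x s N]
      additive_coset_eq_iff[OF that(1)] that(5) by blast
  have fS: "f k \<in> S2 \<longleftrightarrow> k \<in> S1" if k: "k \<in> K1" for k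
  proof
    assume "f k \<in> S2"
    then have "\<phi> (?p k) \<in> \<phi> ` ?p ` S1"
      unfolding phiS qf[OF k, symmetric] by (rule imageI)
    then obtain s where s: "s \<in> S1" "\<phi> (?p k) = \<phi> (?p s)"
      unfolding image_image by (rule imageE)
    have "?p k = ?p s"
      by (rule inj_onD[OF bij_betw_imp_inj_on[OF phi] s(2)]) (use k SK1 s(1) in auto)
    then show "k \<in> S1"
      by (rule saturated[OF N1(1) S1 N1(2) s(1)])
  next
    assume "k \<in> S1"
    then have "?q (f k) \<in> ?q ` S2"
      unfolding phiS[symmetric] qf[OF k] by (intro imageI)
    then obtain s where s: "s \<in> S2" "?q (f k) = ?q s"
      by (rule imageE)
    from s(2) show "f k \<in> S2"
      by (rule saturated[OF N2(1) S2 N2(2) s(1)])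
  qed
  have psif: "\<psi> (ring_comm s k) = ring_comm (f s) (f k)" if "s \<in> S1" "k \<in> K1" for s k
  proof -
    have s: "s \<in> K1"
      using that SK1 by blast
    show ?thesis
      \<comment> \<open>By the choice of \<open>f\<close>, the elements \<open>f s\<close> and
        \<open>f k\<close> are admissible representatives of the image cosets.\<close>
      using compat[rule_format, OF that(1) _ that(2) fK[OF that(2)] qf[OF s, symmetric]
          qf[OF that(2), symmetric]] that(1) fS[OF s]
      by blast
  qed
  have 0: "0 \<in> S1" "0 \<in> K1"
    using S1 SK1 by (auto simp: subring_set_def)
  \<comment> \<open>The lift need not fix 0, but [0, 0] = 0 is sent to [f 0, f 0], which vanishes in
    any case.\<close>
  have psi0: "\<psi> 0 = 0"
    using psif[OF 0] by (simp add: ring_comm_def)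
  have mem0: "0 \<in> commutator_group S1 K1"
    using ring_comm_in_commutator_group[OF 0] by (simp add: ring_comm_def)
  have "f s * f k = f k * f s \<longleftrightarrow> s * k = k * s" if "s \<in> S1" "k \<in> K1" for s k
    using inj_on_eq_iff[OF bij_betw_imp_inj_on[OF psi] ring_comm_in_commutator_group[OF that] mem0]
      psif[OF that] psi0
    by (simp flip: ring_comm_eq_0_iff)
  with f fS show ?thesis
    using that by blast
qed

theorem theorem5p2:
  fixes S1 K1 :: "'a::{ring,finite} set" and S2 K2 :: "'b::{ring,finite} set"
  assumes "subring_set S1" and "subring_set K1" and "S1 \<subseteq> K1"
    and "subring_set S2" and "subring_set K2" and "S2 \<subseteq> K2"
    and "generalized_Z_isoclinic S1 K1 S2 K2"
    and "card (ring_center K1 \<inter> S1) = card (ring_center K2 \<inter> S2)"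
    and "card (ring_center K1) = card (ring_center K2)"
  shows "digraph_iso (with_proj (noncommuting_graph S1 K1)) (with_proj (noncommuting_graph S2 K2))"
proof -
  obtain f where f: "bij_betw f K1 K2"
    and fS: "\<And>k. k \<in> K1 \<Longrightarrow> f k \<in> S2 \<longleftrightarrow> k \<in> S1"
    and comm: "\<And>s k. s \<in> S1 \<Longrightarrow> k \<in> K1 \<Longrightarrow> f s * f k = f k * f s \<longleftrightarrow> s * k = k * s"
    using isoclinic_lift[OF assms(1-6) finite finite assms(7,8)] by blast
  have inj: "inj_on f K1" and im: "f ` K1 = K2"
    using f by (auto simp: bij_betw_def)
  \<comment> \<open>Turns the quantifier over \<open>S2\<close> in the centralizer into one over
    \<open>S1\<close>, where \<open>comm\<close> applies.\<close>
  have S2: "S2 = f ` S1"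
    using im fS assms(3,6) by blast
  have C: "f k \<in> ring_centralizer K2 S2 \<longleftrightarrow> k \<in> ring_centralizer K1 S1" if "k \<in> K1" for k
    using that im comm[OF _ that] unfolding ring_centralizer_def S2 by (auto simp: eq_commute)
  have "bij_betw f (K1 - ring_centralizer K1 S1) (K2 - ring_centralizer K2 S2)"
    using inj im C by (auto simp: bij_betw_def intro: inj_on_subset)
  moreover have "f a * f b \<noteq> f b * f a \<longleftrightarrow> a * b \<noteq> b * a"
    if "a \<in> K1" "b \<in> K1" "a \<in> S1 \<or> b \<in> S1" for a b
    \<comment> \<open>Either endpoint may be the one in \<open>S1\<close>, whereas
      \<open>comm\<close> wants it first.\<close>
    using that comm[of a b] comm[of b a] by metis
  ultimately show ?thesis
    unfolding digraph_iso_noncommuting_graph_iff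
    using inj im C fS
    by (intro exI[of _ f]) (auto simp: noncommuting_graph_def inj_on_eq_iff)
qed

end
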